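(* Let $-\frac12\leq\alpha<1$. For every $f\in\mathcal{C}(\alpha)$ one has $$|S'_f(0)|\leq 4(1-\alpha).$$ This bound is sharp, i.e., for each such $\alpha$ there is a function $f\in\mathcal{C}(\alpha)$ for which equality holds.
   Context: Let $\mathbb{D}=\{z\in\mathbb{C}:|z|<1\}$, and let $\mathcal{A}$ be the family of functions $f$ analytic in $\mathbb{D}$ with $f(0)=0$ and $f'(0)=1$. For $-\frac12\leq\alpha<1$, $\mathcal{C}(\alpha)$ is the class of $f\in\mathcal{A}$ with $f'(z)\neq0$ in $\mathbb{D}$ (so that the following expression is defined) and $$\operatorname{Re}\left[1+\frac{zf''(z)}{f'(z)}\right]>\alpha\quad\text{for all } z\in\mathbb{D}.$$ For a locally univalent function $f$ in $\mathbb{D}$, the Schwarzian derivative is $$S_f(z)=\left(\frac{f''(z)}{f'(z)}\right)'-\frac12\left(\frac{f''(z)}{f'(z)}\right)^2,$$ and $S'_f(0)$ denotes the value at $0$ of the derivative of the function $S_f$. *)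

theory Defs
  imports "HOL-Complex_Analysis.Complex_Analysis"
begin

text \<open>
  Functions on the unit disk \<^term>\<open>ball (0::complex) 1\<close> are total functions on the complex
  plane; their values outside the disk are irrelevant, since the disk is open and only
  derivatives at its points are used.
\<close>

definition normalized_analytic :: "(complex \<Rightarrow> complex) set" where
  "normalized_analytic = {f. f holomorphic_on ball 0 1 \<and> f 0 = 0 \<and> deriv f 0 = 1}"

definition convex_class :: "real \<Rightarrow> (complex \<Rightarrow> complex) set" where
  "convex_class \<alpha> = {f \<in> normalized_analytic.
     (\<forall>z\<in>ball 0 1. deriv f z \<noteq> 0) \<and>
     (\<forall>z\<in>ball 0 1. Re (1 + z * deriv (deriv f) z / deriv f z) > \<alpha>)}"

definition schwarzian :: "(complex \<Rightarrow> complex) \<Rightarrow> complex \<Rightarrow> complex" where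
  "schwarzian f z =
     deriv (\<lambda>w. deriv (deriv f) w / deriv f w) z - 1 / 2 * (deriv (deriv f) z / deriv f z)\<^sup>2"

end

theory Submission
  imports Defs
begin

text \<open>
  Put \<open>c = 2 (1 - \<alpha>)\<close> and \<open>T = f'' / f'\<close>. Since \<open>Re (z T) > - c / 2\<close>, the Schwarz lemma gives
  \<open>T = \<phi> (c + z T)\<close> with \<open>\<bar>\<phi>\<bar> \<le> 1\<close> on the disk. If \<open>\<phi> = a + b z + d z\<^sup>2 + \<dots>\<close>, then
  \<open>S'\<^sub>f(0) = c (2 d + (4 - c) a b + (2 - c) a\<^sup>3)\<close>. The second factor is affine in \<open>c\<close>, and
  \<open>\<alpha> \<ge> - 1 / 2\<close> means \<open>c \<le> 3\<close>, so it suffices to bound it by 2 for \<open>c = 0\<close> and \<open>c = 3\<close>.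
  Two steps of the Schur algorithm express \<open>b\<close> and \<open>d\<close> by parameters of modulus at most 1 and
  reduce this to algebra. Equality is attained for \<open>\<phi> = z\<^sup>2\<close>,
  that is, \<open>f' = (1 - z\<^sup>3) powr (- c / 3)\<close>.
\<close>

section \<open>Taylor coefficients at 0 and the Schwarz lemma\<close>

text \<open>Multiplying by \<open>z\<close> shifts Taylor coefficients by one, and the factor 2 is
  the quotient of the factorials. Later, values and first derivatives at 0 of Schur parameters are
  turned by it into derivatives of the function they come from.\<close>

lemma deriv_affine_mult_0:
  assumes g: "g holomorphic_on ball 0 1"
    and h: "\<And>z. z \<in> ball 0 1 \<Longrightarrow> h z = k + z * g z"
  shows "deriv h 0 = g 0" and "deriv (deriv h) 0 = 2 * deriv g 0"
proof -
  have dg: "(g has_field_derivative deriv g z) (at z)" if "z \<in> ball 0 1" for z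
    using g that by (auto intro: holomorphic_derivI)
  have dg': "(deriv g has_field_derivative deriv (deriv g) z) (at z)" if "z \<in> ball 0 1" for z
    using g that by (auto intro!: holomorphic_derivI holomorphic_deriv)
  have dh: "deriv h z = g z + z * deriv g z" if z: "z \<in> ball 0 1" for z
  proof -
    have "((\<lambda>z. k + z * g z) has_field_derivative g z + z * deriv g z) (at z)"
      by (rule derivative_eq_intros dg[OF z] refl | simp)+
    then have "(h has_field_derivative g z + z * deriv g z) (at z)"
      using z h by (auto intro: has_field_derivative_transform_within_open[of _ _ _ "ball 0 1"])
    then show ?thesis
      by (rule DERIV_imp_deriv)
  qed
  show "deriv h 0 = g 0"
    by (simp add: dh)
  have z: "(0::complex) \<in> ball 0 1"
    by simp
  have "((\<lambda>z. g z + z * deriv g z) has_field_derivative 2 * deriv g 0) (at 0)"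
    by (rule derivative_eq_intros dg[OF z] dg'[OF z] refl | simp)+
  then have "(deriv h has_field_derivative 2 * deriv g 0) (at 0)"
    using dh by (auto intro: has_field_derivative_transform_within_open[of _ _ _ "ball 0 1"])
  then show "deriv (deriv h) 0 = 2 * deriv g 0"
    by (rule DERIV_imp_deriv)
qed

lemma Schwarz_quotient:
  assumes "f holomorphic_on ball 0 1" and "f 0 = 0" and "\<And>z. norm z < 1 \<Longrightarrow> norm (f z) < 1"
  obtains h where "h holomorphic_on ball 0 1" and "\<And>z. norm z < 1 \<Longrightarrow> f z = z * h z"
    and "\<And>z. norm z < 1 \<Longrightarrow> norm (h z) \<le> 1"
proof -
  obtain h where h: "h holomorphic_on ball 0 1" "\<And>z. norm z < 1 \<Longrightarrow> f z = z * h z" "deriv f 0 = h 0"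
    using Schwarz3 assms(1,2) by blast
  have "norm (h z) \<le> 1" if z: "norm z < 1" for z
  proof (cases "z = 0")
    case True
    then show ?thesis
      \<comment> \<open>Nothing can be cancelled at the origin; there \<open>h 0\<close> is the
        derivative of \<open>f\<close>, which the Schwarz lemma bounds as well.\<close>
      using Schwarz_Lemma(2)[OF assms(1,2,3) z] h(3) by simp
  next
    case False
    have "norm z * norm (h z) \<le> norm z * 1"
      using Schwarz_Lemma(1)[OF assms(1,2,3) z] h(2)[OF z] by (simp add: norm_mult)
    then show ?thesis
      using False mult_left_le_imp_le zero_less_norm_iff by blast
  qed
  then show ?thesis
    using that h by blast
qed

section \<open>The Schur algorithm\<close>

text \<open>For two points of the open disk the right-hand side is positive, which is why the
  Moebius map \<open>(w - a) / (1 - cnj a * w)\<close> sends the disk into itself.\<close>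

lemma Moebius_norm_diff:
  "(norm (1 - cnj a * w))\<^sup>2 - (norm (w - a))\<^sup>2 = (1 - (norm a)\<^sup>2) * (1 - (norm w)\<^sup>2)"
  unfolding cmod_power2 by (simp add: power2_eq_square algebra_simps)

text \<open>The function \<open>\<psi>\<close> comes from moving \<open>\<phi> 0\<close> to the
  origin by a Moebius map and dividing by \<open>z\<close>. The relation is stated with the
  denominator multiplied out, so that it also covers unimodular constants, where that denominator
  vanishes.\<close>

lemma Schur_step:
  assumes hol: "\<phi> holomorphic_on ball 0 1" and le: "\<And>z. norm z < 1 \<Longrightarrow> norm (\<phi> z) \<le> 1"
  obtains \<psi> where "\<psi> holomorphic_on ball 0 1" and "\<And>z. norm z < 1 \<Longrightarrow> norm (\<psi> z) \<le> 1"
    and "\<And>z. norm z < 1 \<Longrightarrow> \<phi> z = \<phi> 0 + z * (\<psi> z * (1 - cnj (\<phi> 0) * \<phi> z))"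
proof (cases "\<exists>w. norm w < 1 \<and> norm (\<phi> w) = 1")
  case True
  then obtain w where w: "norm w < 1" "norm (\<phi> w) = 1"
    by blast
  \<comment> \<open>By the maximum principle, \<open>\<phi>\<close> is constant once its modulus
    reaches 1 inside the disk; then \<open>\<psi> = 0\<close> will do.\<close>
  have "ball w (1 - norm w) \<subseteq> ball 0 1"
    by (simp add: ball_subset_ball_iff dist_norm)
  then have "\<phi> constant_on ball 0 1"
    using w le by (intro Schwarz2[OF hol, of "1 - norm w" w]) (auto simp: dist_norm subset_iff)
  then have const: "\<phi> z = \<phi> 0" if "norm z < 1" for z
    using that by (auto simp: constant_on_def)
  show ?thesis
  proof (rule that[of "\<lambda>_. 0"])
    show "\<phi> z = \<phi> 0 + z * (0 * (1 - cnj (\<phi> 0) * \<phi> z))" if "norm z < 1" for z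
      unfolding mult_zero_left mult_zero_right add_0_right by (rule const[OF that])
  qed simp_all
next
  case False
  define a where "a = \<phi> 0"
  have lt: "norm (\<phi> z) < 1" if "norm z < 1" for z
    using False le that less_eq_real_def by blast
  have a: "norm a < 1"
    by (simp add: a_def lt)
  have less: "norm (\<phi> z - a) < norm (1 - cnj a * \<phi> z)" if "norm z < 1" for z
  proof -
    have "(1 - (norm a)\<^sup>2) * (1 - (norm (\<phi> z))\<^sup>2) > 0"
      using a lt[OF that] by (intro mult_pos_pos) (auto simp: power_less_one_iff abs_square_less_1)
    then have "(norm (\<phi> z - a))\<^sup>2 < (norm (1 - cnj a * \<phi> z))\<^sup>2"
      by (simp flip: Moebius_norm_diff)
    then show ?thesis
      by (simp add: power_less_imp_less_base)
  qed
  then have nz: "1 - cnj a * \<phi> z \<noteq> 0" if "norm z < 1" for z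
    using that by force
  obtain \<psi> where \<psi>: "\<psi> holomorphic_on ball 0 1" "\<And>z. norm z < 1 \<Longrightarrow> norm (\<psi> z) \<le> 1"
    "\<And>z. norm z < 1 \<Longrightarrow> (\<phi> z - a) / (1 - cnj a * \<phi> z) = z * \<psi> z"
  proof (rule Schwarz_quotient[of "\<lambda>z. (\<phi> z - a) / (1 - cnj a * \<phi> z)"])
    show "(\<lambda>z. (\<phi> z - a) / (1 - cnj a * \<phi> z)) holomorphic_on ball 0 1"
      using nz by (intro holomorphic_intros hol) auto
    show "norm ((\<phi> z - a) / (1 - cnj a * \<phi> z)) < 1" if "norm z < 1" for z
      using less[OF that] nz[OF that] by (simp add: norm_divide divide_less_eq)
  qed (auto simp: a_def)
  have "\<phi> z = a + z * (\<psi> z * (1 - cnj a * \<phi> z))" if "norm z < 1" for z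
    using \<psi>(3)[OF that] nz[OF that] by (simp add: divide_eq_eq algebra_simps)
  then show ?thesis
    using that \<psi> by (auto simp: a_def)
qed

text \<open>Differentiating the Schur step at 0 leaves
  \<open>\<psi> 0 * (1 - cnj (\<phi> 0) * \<phi> 0)\<close>, and \<open>\<psi> 0\<close> has modulus
  at most 1.\<close>

lemma Schwarz_Pick_0:
  assumes hol: "\<phi> holomorphic_on ball 0 1" and le: "\<And>z. norm z < 1 \<Longrightarrow> norm (\<phi> z) \<le> 1"
  shows "norm (deriv \<phi> 0) \<le> 1 - (norm (\<phi> 0))\<^sup>2"
proof -
  obtain \<psi> where \<psi>: "\<psi> holomorphic_on ball 0 1" "\<And>z. norm z < 1 \<Longrightarrow> norm (\<psi> z) \<le> 1"
    "\<And>z. norm z < 1 \<Longrightarrow> \<phi> z = \<phi> 0 + z * (\<psi> z * (1 - cnj (\<phi> 0) * \<phi> z))"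
    using Schur_step[OF assms] by blast
  have "deriv \<phi> 0 = \<psi> 0 * (1 - cnj (\<phi> 0) * \<phi> 0)"
    by (rule deriv_affine_mult_0(1)[where k = "\<phi> 0"]) (use \<psi>(3) in \<open>auto intro!: holomorphic_intros \<psi> hol\<close>)
  also have "1 - cnj (\<phi> 0) * \<phi> 0 = of_real (1 - (norm (\<phi> 0))\<^sup>2)"
    by (simp add: complex_norm_square mult.commute del: of_real_power)
  finally have "norm (deriv \<phi> 0) = norm (\<psi> 0) * \<bar>1 - (norm (\<phi> 0))\<^sup>2\<bar>"
    by (simp only: norm_mult norm_of_real)
  also have "\<dots> \<le> 1 * \<bar>1 - (norm (\<phi> 0))\<^sup>2\<bar>"
    using \<psi>(2)[of 0] by (intro mult_right_mono) auto
  also have "\<dots> = 1 - (norm (\<phi> 0))\<^sup>2"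
    using le[of 0] by (simp add: power_le_one)
  finally show ?thesis .
qed

text \<open>After one Schur step the parameters are \<open>\<gamma> = \<psi> 0\<close> and
  \<open>\<delta> = deriv \<psi> 0\<close>. The second step enters only through the Schwarz-Pick
  bound for \<open>\<psi>\<close>, which is the bound on \<open>\<delta>\<close>.\<close>

lemma Schur_coefficients:
  assumes hol: "\<phi> holomorphic_on ball 0 1" and le: "\<And>z. norm z < 1 \<Longrightarrow> norm (\<phi> z) \<le> 1"
  obtains \<gamma> \<delta> where "norm \<gamma> \<le> 1" and "norm \<delta> \<le> 1 - (norm \<gamma>)\<^sup>2"
    and "deriv \<phi> 0 = of_real (1 - (norm (\<phi> 0))\<^sup>2) * \<gamma>"
    and "deriv (deriv \<phi>) 0 = 2 * (of_real (1 - (norm (\<phi> 0))\<^sup>2) * (\<delta> - cnj (\<phi> 0) * \<gamma>\<^sup>2))"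
proof -
  obtain \<psi> where \<psi>: "\<psi> holomorphic_on ball 0 1" "\<And>z. norm z < 1 \<Longrightarrow> norm (\<psi> z) \<le> 1"
    "\<And>z. norm z < 1 \<Longrightarrow> \<phi> z = \<phi> 0 + z * (\<psi> z * (1 - cnj (\<phi> 0) * \<phi> z))"
    using Schur_step[OF assms] by blast
  define g where "g = (\<lambda>z. \<psi> z * (1 - cnj (\<phi> 0) * \<phi> z))"
  have g: "g holomorphic_on ball 0 1"
    unfolding g_def by (intro holomorphic_intros \<psi> hol)
  have r: "of_real (1 - (norm (\<phi> 0))\<^sup>2) = 1 - cnj (\<phi> 0) * \<phi> 0"
    by (simp add: complex_norm_square mult.commute del: of_real_power)
  have \<phi>g: "\<phi> z = \<phi> 0 + z * g z" if "z \<in> ball 0 1" for z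
    using \<psi>(3) that by (simp add: g_def)
  have b: "deriv \<phi> 0 = of_real (1 - (norm (\<phi> 0))\<^sup>2) * \<psi> 0"
    unfolding r using deriv_affine_mult_0(1)[OF g \<phi>g] by (simp add: g_def)
  have d\<phi>: "(\<phi> has_field_derivative deriv \<phi> 0) (at 0)"
    and d\<psi>: "(\<psi> has_field_derivative deriv \<psi> 0) (at 0)"
    using hol \<psi>(1) by (auto intro!: holomorphic_derivI[of _ "ball 0 1"])
  have "(g has_field_derivative
      deriv \<psi> 0 * (1 - cnj (\<phi> 0) * \<phi> 0) - \<psi> 0 * cnj (\<phi> 0) * deriv \<phi> 0) (at 0)"
    unfolding g_def by (rule derivative_eq_intros d\<phi> d\<psi> refl | simp)+
  then have "deriv g 0 = deriv \<psi> 0 * (1 - cnj (\<phi> 0) * \<phi> 0) - \<psi> 0 * cnj (\<phi> 0) * deriv \<phi> 0"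
    by (rule DERIV_imp_deriv)
  also have "\<dots> = of_real (1 - (norm (\<phi> 0))\<^sup>2) * (deriv \<psi> 0 - cnj (\<phi> 0) * (\<psi> 0)\<^sup>2)"
    unfolding b r by (simp add: algebra_simps power2_eq_square)
  finally have d: "deriv (deriv \<phi>) 0 =
      2 * (of_real (1 - (norm (\<phi> 0))\<^sup>2) * (deriv \<psi> 0 - cnj (\<phi> 0) * (\<psi> 0)\<^sup>2))"
    using deriv_affine_mult_0(2)[OF g \<phi>g] by simp
  show ?thesis
    using that[of "\<psi> 0" "deriv \<psi> 0"] \<psi>(2)[of 0] Schwarz_Pick_0[OF \<psi>(1,2)] b d by simp
qed

section \<open>Coefficient inequalities for the end cases and their interpolation\<close>

text \<open>
  The next lemma is the case \<open>c = 0\<close>. With \<open>s\<^sup>2 = 1 - \<bar>a\<bar>\<^sup>2\<close>, the part without \<open>\<delta>\<close> is the pairing of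
  \<open>(a, s \<gamma>)\<close> with \<open>(a\<^sup>2 + s\<^sup>2 \<gamma>, s (a - cnj a \<gamma>))\<close>, and both vectors have
  squared norm \<open>\<bar>a\<bar>\<^sup>2 + s\<^sup>2 \<bar>\<gamma>\<bar>\<^sup>2\<close>. The triangle inequality on its three terms would be too weak.
\<close>

lemma Caratheodory_third_coefficient_bound:
  fixes a \<gamma> \<delta> :: complex
  defines "s \<equiv> 1 - (norm a)\<^sup>2"
  assumes a: "norm a \<le> 1" and \<delta>: "norm \<delta> \<le> 1 - (norm \<gamma>)\<^sup>2"
  shows "norm (of_real s * (\<delta> - cnj a * \<gamma>\<^sup>2) + 2 * a * (of_real s * \<gamma>) + a ^ 3) \<le> 1"
proof -
  define u v where "u = a\<^sup>2 + of_real s * \<gamma>" and "v = a - cnj a * \<gamma>"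
  define n where "n = (norm a)\<^sup>2 + s * (norm \<gamma>)\<^sup>2"
  have s: "s \<ge> 0"
    using a by (simp add: s_def power_le_one)
  have uv: "(norm u)\<^sup>2 + s * (norm v)\<^sup>2 = n"
    unfolding u_def v_def n_def s_def cmod_power2
    by (simp add: power2_eq_square algebra_simps)
  have "norm (a * u + of_real s * \<gamma> * v) \<le> norm a * norm u + s * (norm \<gamma> * norm v)"
    using s norm_triangle_ineq[of "a * u" "of_real s * \<gamma> * v"] by (simp add: norm_mult)
  \<comment> \<open>Both vectors have squared norm \<open>n\<close>, so the arithmetic-geometric
    mean inequality on each product gives the Cauchy-Schwarz bound \<open>n\<close>
    directly.\<close>
  also have "\<dots> \<le> ((norm a)\<^sup>2 + (norm u)\<^sup>2) / 2 + s * (((norm \<gamma>)\<^sup>2 + (norm v)\<^sup>2) / 2)"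
    using s sum_squares_bound[of "norm a" "norm u"] sum_squares_bound[of "norm \<gamma>" "norm v"]
    by (intro add_mono mult_left_mono) auto
  also have "\<dots> = n"
    using uv by (simp add: n_def field_simps)
  finally have 1: "norm (a * u + of_real s * \<gamma> * v) \<le> n" .
  have 2: "norm (of_real s * \<delta>) \<le> s * (1 - (norm \<gamma>)\<^sup>2)"
    using s \<delta> by (simp add: norm_mult mult_left_mono)
  have "of_real s * (\<delta> - cnj a * \<gamma>\<^sup>2) + 2 * a * (of_real s * \<gamma>) + a ^ 3
      = (a * u + of_real s * \<gamma> * v) + of_real s * \<delta>"
    by (simp add: u_def v_def power2_eq_square power3_eq_cube algebra_simps)
  also have "norm \<dots> \<le> n + s * (1 - (norm \<gamma>)\<^sup>2)"
    using 1 2 norm_triangle_le by (meson add_mono)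
  also have "\<dots> = 1"
    by (simp add: n_def s_def algebra_simps)
  finally show ?thesis .
qed

text \<open>This is the case \<open>c = 3\<close>, divided by 2. Here the coefficients of the mixed
  and cubic terms are small enough for the triangle inequality, which leaves a real polynomial
  inequality in the moduli of \<open>a\<close> and \<open>\<gamma>\<close>.\<close>

lemma half_Caratheodory_third_coefficient_bound:
  fixes a \<gamma> \<delta> :: complex
  defines "s \<equiv> 1 - (norm a)\<^sup>2"
  assumes a: "norm a \<le> 1" and \<delta>: "norm \<delta> \<le> 1 - (norm \<gamma>)\<^sup>2"
  shows "norm (of_real s * (\<delta> - cnj a * \<gamma>\<^sup>2) + a * (of_real s * \<gamma>) / 2 - a ^ 3 / 2) \<le> 1"
proof -
  define x y where "x = norm a" and "y = norm \<gamma>"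
  have x: "0 \<le> x" "x \<le> 1"
    using a by (auto simp: x_def)
  have s: "s \<ge> 0"
    using a by (simp add: s_def power_le_one)
  have "norm (of_real s * (\<delta> - cnj a * \<gamma>\<^sup>2) + a * (of_real s * \<gamma>) / 2 - a ^ 3 / 2)
      \<le> norm (of_real s * (\<delta> - cnj a * \<gamma>\<^sup>2)) + norm (a * (of_real s * \<gamma>) / 2) + norm (a ^ 3 / 2)"
    by (rule order_trans[OF norm_triangle_ineq4 add_right_mono[OF norm_triangle_ineq]])
  also have "\<dots> = s * norm (\<delta> - cnj a * \<gamma>\<^sup>2) + s * (x * y) / 2 + x ^ 3 / 2"
    using s by (simp add: norm_mult norm_divide norm_power x_def y_def)
  also have "\<dots> \<le> s * (1 - y\<^sup>2 + x * y\<^sup>2) + s * (x * y) / 2 + x ^ 3 / 2"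
  proof -
    have "norm (\<delta> - cnj a * \<gamma>\<^sup>2) \<le> norm \<delta> + norm (cnj a * \<gamma>\<^sup>2)"
      by (rule norm_triangle_ineq4)
    also have "\<dots> \<le> 1 - y\<^sup>2 + x * y\<^sup>2"
      using \<delta> by (simp add: norm_mult norm_power x_def y_def)
    finally show ?thesis
      using s by (simp add: mult_left_mono)
  qed
  also have "\<dots> \<le> 1"
  proof -
    \<comment> \<open>The gap to 1 is quadratic in \<open>y\<close>, with leading coefficient
      \<open>(1 + x) * (1 - x)\<^sup>2\<close>. Completing the square in \<open>y * (1 - x)\<close>
      leaves a remainder that is nonnegative because \<open>x \<le> 1\<close>.\<close>
    have "0 \<le> (1 + x) * (y * (1 - x) - x / 4)\<^sup>2 + x\<^sup>2 * (15 - 9 * x) / 16"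
      using x by (intro add_nonneg_nonneg mult_nonneg_nonneg divide_nonneg_nonneg) auto
    also have "\<dots> = 1 - (s * (1 - y\<^sup>2 + x * y\<^sup>2) + s * (x * y) / 2 + x ^ 3 / 2)"
      unfolding s_def x_def[symmetric] by (simp add: field_simps power2_eq_square power3_eq_cube)
    finally show ?thesis
      by simp
  qed
  finally show ?thesis .
qed

lemma Schwarzian_functional_bound:
  fixes c :: real and \<phi> :: "complex \<Rightarrow> complex"
  assumes hol: "\<phi> holomorphic_on ball 0 1" and le: "\<And>z. norm z < 1 \<Longrightarrow> norm (\<phi> z) \<le> 1"
    and c: "0 \<le> c" "c \<le> 3"
  shows "norm (deriv (deriv \<phi>) 0 + (4 - c) * \<phi> 0 * deriv \<phi> 0 + (2 - c) * \<phi> 0 ^ 3) \<le> 2"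
proof -
  define a b d where "a = \<phi> 0" and "b = deriv \<phi> 0" and "d = deriv (deriv \<phi>) 0 / 2"
  obtain \<gamma> \<delta> where \<gamma>\<delta>: "norm \<gamma> \<le> 1" "norm \<delta> \<le> 1 - (norm \<gamma>)\<^sup>2"
    and b: "b = of_real (1 - (norm a)\<^sup>2) * \<gamma>"
    and d: "d = of_real (1 - (norm a)\<^sup>2) * (\<delta> - cnj a * \<gamma>\<^sup>2)"
    using Schur_coefficients[OF hol le] unfolding a_def b_def d_def
    by (metis nonzero_mult_div_cancel_left zero_neq_numeral)
  have a: "norm a \<le> 1"
    using le[of 0] by (simp add: a_def)
  have 1: "norm (d + 2 * a * b + a ^ 3) \<le> 1"
    using Caratheodory_third_coefficient_bound[OF a \<gamma>\<delta>(2)] unfolding b d .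
  have 2: "norm (d + a * b / 2 - a ^ 3 / 2) \<le> 1"
    using half_Caratheodory_third_coefficient_bound[OF a \<gamma>\<delta>(2)] unfolding b d .
  \<comment> \<open>The convex weight that places \<open>c\<close> between the end cases 0 and 3.
    The coefficients match: \<open>4 * (1 - t) + t = 4 - c\<close> and
    \<open>2 * (1 - t) - t = 2 - c\<close>.\<close>
  define t where "t = c / 3"
  have t: "0 \<le> t" "t \<le> 1" and ct: "c = 3 * t"
    using c by (auto simp: t_def)
  have "deriv (deriv \<phi>) 0 + (4 - c) * \<phi> 0 * deriv \<phi> 0 + (2 - c) * \<phi> 0 ^ 3
      = of_real (2 * (1 - t)) * (d + 2 * a * b + a ^ 3)
        + of_real (2 * t) * (d + a * b / 2 - a ^ 3 / 2)"
    unfolding ct a_def b_def d_def by (simp add: field_simps)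
  also have "norm \<dots> \<le> 2 * (1 - t) * norm (d + 2 * a * b + a ^ 3)
        + 2 * t * norm (d + a * b / 2 - a ^ 3 / 2)"
    using t by (intro order_trans[OF norm_triangle_ineq]) (simp only: norm_mult norm_of_real, simp)
  also have "\<dots> \<le> 2 * (1 - t) * 1 + 2 * t * 1"
    using t 1 2 by (intro add_mono mult_left_mono) auto
  finally show ?thesis
    by simp
qed

section \<open>The Schwarzian in terms of the Schwarz function\<close>

text \<open>With \<open>T\<close> the quotient in \<open>eq\<close>, differentiating the equation at
  0 yields \<open>T 0 = c * \<phi> 0\<close>, then \<open>T'\<close> and \<open>T''\<close> at 0,
  and the derivative of the Schwarzian is \<open>T'' - T * T'\<close>. No bound on
  \<open>\<phi>\<close> enters, so the formula serves both the estimate and the extremal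
  function.\<close>

lemma deriv_schwarzian_0:
  fixes c :: complex
  assumes T: "(\<lambda>z. deriv (deriv f) z / deriv f z) holomorphic_on ball 0 1"
    and \<phi>: "\<phi> holomorphic_on ball 0 1"
    and eq: "\<And>z. norm z < 1 \<Longrightarrow>
      deriv (deriv f) z / deriv f z = \<phi> z * (c + z * (deriv (deriv f) z / deriv f z))"
  shows "deriv (schwarzian f) 0
    = c * (deriv (deriv \<phi>) 0 + (4 - c) * \<phi> 0 * deriv \<phi> 0 + (2 - c) * \<phi> 0 ^ 3)"
proof -
  define T where "T = (\<lambda>z. deriv (deriv f) z / deriv f z)"
  have eq: "T z = \<phi> z * (c + z * T z)" if "norm z < 1" for z
    using assms(3)[OF that] by (simp only: T_def)
  have hol: "T holomorphic_on ball 0 1"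
    using T by (simp add: T_def)
  have dT: "(T has_field_derivative deriv T z) (at z)"
    and dT': "(deriv T has_field_derivative deriv (deriv T) z) (at z)"
    and d\<phi>: "(\<phi> has_field_derivative deriv \<phi> z) (at z)"
    and d\<phi>': "(deriv \<phi> has_field_derivative deriv (deriv \<phi>) z) (at z)" if "z \<in> ball 0 1" for z
    using hol \<phi> that by (auto intro!: holomorphic_derivI[of _ "ball 0 1"] holomorphic_deriv)
  have z: "(0::complex) \<in> ball 0 1"
    by simp
  have D1: "deriv T z = deriv \<phi> z * (c + z * T z) + \<phi> z * (T z + z * deriv T z)"
    if z: "z \<in> ball 0 1" for z
  proof -
    have "((\<lambda>z. \<phi> z * (c + z * T z)) has_field_derivative
        deriv \<phi> z * (c + z * T z) + \<phi> z * (T z + z * deriv T z)) (at z)"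
      by (rule derivative_eq_intros dT[OF z] d\<phi>[OF z] refl | simp add: algebra_simps)+
    then have "(T has_field_derivative
        deriv \<phi> z * (c + z * T z) + \<phi> z * (T z + z * deriv T z)) (at z)"
      by (rule has_field_derivative_transform_within_open[of _ _ _ "ball 0 1"]) (use z eq in auto)
    then show ?thesis
      by (rule DERIV_imp_deriv)
  qed
  have "((\<lambda>z. deriv \<phi> z * (c + z * T z) + \<phi> z * (T z + z * deriv T z)) has_field_derivative
      deriv (deriv \<phi>) 0 * c + 2 * deriv \<phi> 0 * T 0 + 2 * \<phi> 0 * deriv T 0) (at 0)"
    by (rule derivative_eq_intros dT[OF z] dT'[OF z] d\<phi>[OF z] d\<phi>'[OF z] refl
        | simp add: algebra_simps)+
  then have "(deriv T has_field_derivative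
      deriv (deriv \<phi>) 0 * c + 2 * deriv \<phi> 0 * T 0 + 2 * \<phi> 0 * deriv T 0) (at 0)"
    by (rule has_field_derivative_transform_within_open[of _ _ _ "ball 0 1"]) (use D1 in auto)
  then have D2: "deriv (deriv T) 0
      = deriv (deriv \<phi>) 0 * c + 2 * deriv \<phi> 0 * T 0 + 2 * \<phi> 0 * deriv T 0"
    by (rule DERIV_imp_deriv)
  have S: "schwarzian f = (\<lambda>z. deriv T z - 1 / 2 * (T z)\<^sup>2)"
    by (simp add: fun_eq_iff schwarzian_def T_def)
  have "(schwarzian f has_field_derivative deriv (deriv T) 0 - T 0 * deriv T 0) (at 0)"
    unfolding S by (rule derivative_eq_intros dT[OF z] dT'[OF z] refl | simp)+
  then have "deriv (schwarzian f) 0 = deriv (deriv T) 0 - T 0 * deriv T 0"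
    by (rule DERIV_imp_deriv)
  then show ?thesis
    using D1[of 0] D2 eq[of 0] by (simp add: algebra_simps power3_eq_cube)
qed

text \<open>The half-plane condition says that \<open>z * T z\<close> is closer to 0 than to
  \<open>- c\<close>. Hence \<open>z * T z / (c + z * T z)\<close> maps the disk into itself and
  fixes 0, and \<open>\<phi>\<close> is its quotient by \<open>z\<close>.\<close>

lemma convex_class_Schwarz_function:
  assumes f: "f \<in> convex_class \<alpha>" and \<alpha>: "\<alpha> < 1"
  defines "T \<equiv> \<lambda>z. deriv (deriv f) z / deriv f z"
  obtains \<phi> where "\<phi> holomorphic_on ball 0 1" and "\<And>z. norm z < 1 \<Longrightarrow> norm (\<phi> z) \<le> 1"
    and "\<And>z. norm z < 1 \<Longrightarrow> T z = \<phi> z * (of_real (2 * (1 - \<alpha>)) + z * T z)"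
proof -
  define c where "c = 2 * (1 - \<alpha>)"
  have c: "c > 0"
    using \<alpha> by (simp add: c_def)
  have hol: "T holomorphic_on ball 0 1"
    using f unfolding T_def
    by (auto simp: convex_class_def normalized_analytic_def intro!: holomorphic_intros)
  have Re: "Re (z * T z) > - c / 2" if "norm z < 1" for z
  proof -
    have "Re (1 + z * T z) > \<alpha>"
      using f that by (simp add: convex_class_def T_def)
    then have "Re (z * T z) > \<alpha> - 1"
      by (simp only: plus_complex.sel one_complex.sel)
    then show ?thesis
      by (simp add: c_def)
  qed
  have less: "norm (z * T z) < norm (of_real c + z * T z)" if "norm z < 1" for z
  proof -
    \<comment> \<open>This product is the difference of the squared moduli of \<open>c + w\<close>
      and \<open>w\<close> at \<open>w = z * T z\<close>.\<close>
    have "0 < c * (c + 2 * Re (z * T z))"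
      using c Re[OF that] by (intro mult_pos_pos) auto
    then have "(norm (z * T z))\<^sup>2 < (norm (of_real c + z * T z))\<^sup>2"
      unfolding cmod_power2 by (simp add: power2_eq_square algebra_simps)
    then show ?thesis
      by (simp add: power_less_imp_less_base)
  qed
  then have nz: "of_real c + z * T z \<noteq> 0" if "norm z < 1" for z
    using that by force
  obtain h where h: "h holomorphic_on ball 0 1" "\<And>z. norm z < 1 \<Longrightarrow> norm (h z) \<le> 1"
    "\<And>z. norm z < 1 \<Longrightarrow> z * T z / (of_real c + z * T z) = z * h z"
  proof (rule Schwarz_quotient[of "\<lambda>z. z * T z / (of_real c + z * T z)"])
    show "(\<lambda>z. z * T z / (of_real c + z * T z)) holomorphic_on ball 0 1"
      using nz by (intro holomorphic_intros hol) auto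
    show "norm (z * T z / (of_real c + z * T z)) < 1" if "norm z < 1" for z
      using less[OF that] nz[OF that] by (simp add: norm_divide divide_less_eq)
  qed auto
  define \<phi> where "\<phi> = (\<lambda>z. T z / (of_real c + z * T z))"
  have hol\<phi>: "\<phi> holomorphic_on ball 0 1"
    unfolding \<phi>_def using nz by (intro holomorphic_intros hol) auto
  have eq: "\<phi> z = h z" if "z \<in> ball 0 1 - {0}" for z
  proof -
    have "z * \<phi> z = z * h z"
      using h(3)[of z] that by (simp add: \<phi>_def)
    then show ?thesis
      using that by (simp only: mult_cancel_left) auto
  qed
  \<comment> \<open>Cancelling \<open>z\<close> says nothing at the origin, so
    \<open>\<phi> 0\<close> and \<open>h 0\<close> are compared as derivatives of the same product
    at 0.\<close>
  have "z * h z = 0 + z * \<phi> z" if "z \<in> ball 0 1" for z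
    using eq[of z] that by (cases "z = 0") auto
  then have "deriv (\<lambda>z. z * h z) 0 = \<phi> 0"
    by (rule deriv_affine_mult_0(1)[OF hol\<phi>])
  moreover have "deriv (\<lambda>z. z * h z) 0 = h 0"
    by (rule deriv_affine_mult_0(1)[OF h(1), where k = 0]) simp
  ultimately have "\<phi> 0 = h 0"
    by simp
  then have "norm (\<phi> z) \<le> 1" if "norm z < 1" for z
    using eq[of z] h(2)[OF that] that by (cases "z = 0") auto
  moreover have "T z = \<phi> z * (of_real c + z * T z)" if "norm z < 1" for z
    using nz[OF that] by (simp add: \<phi>_def)
  ultimately show ?thesis
    using that hol\<phi> unfolding c_def by blast
qed

section \<open>The extremal function and the sharp bound\<close>

text \<open>Solving \<open>T = \<phi> * (c + z * T)\<close> for \<open>\<phi> = z\<^sup>2\<close>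
  gives the stated quotient. Integrating it once gives \<open>f'\<close>, and a primitive vanishing
  at 0 gives \<open>f\<close>.\<close>

lemma convex_class_extremal:
  assumes \<alpha>: "\<alpha> < 1"
  obtains f where "f \<in> convex_class \<alpha>"
    and "\<And>z. norm z < 1 \<Longrightarrow>
      deriv (deriv f) z / deriv f z = of_real (2 * (1 - \<alpha>)) * z\<^sup>2 / (1 - z ^ 3)"
proof -
  define c where "c = 2 * (1 - \<alpha>)"
  have c: "c > 0"
    using \<alpha> by (simp add: c_def)
  \<comment> \<open>The intended \<open>f'\<close>. The principal logarithm is holomorphic here
    because \<open>1 - z ^ 3\<close> has positive real part on the disk.\<close>
  define g where "g = (\<lambda>z::complex. exp (- of_real (c / 3) * Ln (1 - z ^ 3)))"
  have z3: "norm (z ^ 3) < 1" if "norm z < 1" for z :: complex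
    using that by (simp add: norm_power power_less_one_iff)
  have re: "Re (z ^ 3) < 1" if "norm z < 1" for z :: complex
    using complex_Re_le_cmod[of "z ^ 3"] z3[OF that] by linarith
  have np: "1 - z ^ 3 \<notin> \<real>\<^sub>\<le>\<^sub>0" if "norm z < 1" for z :: complex
    using re[OF that] by (auto simp: complex_nonpos_Reals_iff)
  have nz: "1 - z ^ 3 \<noteq> 0" if "norm z < 1" for z :: complex
    using np[OF that] by auto
  have dg: "(g has_field_derivative g z * (of_real c * z\<^sup>2 / (1 - z ^ 3))) (at z)"
    if "norm z < 1" for z
    unfolding g_def using np[OF that] nz[OF that]
    by (auto intro!: derivative_eq_intros simp: field_simps power2_eq_square)
  have holg: "g holomorphic_on ball 0 1"
    using dg unfolding holomorphic_on_open[OF open_ball] by (meson mem_ball_0)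
  obtain F where F: "\<And>z. z \<in> ball 0 1 \<Longrightarrow> (F has_field_derivative g z) (at z within ball 0 1)"
    using holomorphic_convex_primitive'[OF convex_ball open_ball holg] by blast
  define f where "f = (\<lambda>z. F z - F 0)"
  have df: "(f has_field_derivative g z) (at z)" if "norm z < 1" for z
    using F[of z] that unfolding f_def
    by (auto intro!: derivative_eq_intros simp: at_within_open[of _ "ball 0 1"])
  have f1: "deriv f z = g z" if "norm z < 1" for z
    using df[OF that] by (rule DERIV_imp_deriv)
  have f2: "deriv (deriv f) z = g z * (of_real c * z\<^sup>2 / (1 - z ^ 3))" if "norm z < 1" for z
  proof -
    have "(deriv f has_field_derivative g z * (of_real c * z\<^sup>2 / (1 - z ^ 3))) (at z)"
      using dg[OF that]
      by (rule has_field_derivative_transform_within_open[of _ _ _ "ball 0 1"]) (use f1 that in auto)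
    then show ?thesis
      by (rule DERIV_imp_deriv)
  qed
  have g_nz: "g z \<noteq> 0" for z
    by (simp add: g_def)
  have T: "deriv (deriv f) z / deriv f z = of_real c * z\<^sup>2 / (1 - z ^ 3)" if "norm z < 1" for z
    using f1[OF that] f2[OF that] g_nz by simp
  have "Re (1 + z * deriv (deriv f) z / deriv f z) > \<alpha>" if z: "norm z < 1" for z
  proof -
    \<comment> \<open>The map \<open>w / (1 - w)\<close> sends the disk into this half-plane. Taking
      \<open>w = z ^ 3\<close> and scaling by \<open>c\<close> gives the lower bound
      \<open>- c / 2 = \<alpha> - 1\<close>.\<close>
    have "Re (w / (1 - w)) > - 1 / 2" if w: "norm w < 1" for w :: complex
    proof -
      have "1 - w \<noteq> 0"
        using w by auto
      then have n: "(norm (1 - w))\<^sup>2 > 0"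
        by simp
      have "Re (w / (1 - w)) + 1 / 2 = (1 - (norm w)\<^sup>2) / (2 * (norm (1 - w))\<^sup>2)"
      proof -
        have "w / (1 - w) = w * cnj (1 - w) / of_real ((norm (1 - w))\<^sup>2)"
          using complex_div_cnj by metis
        then have "Re (w / (1 - w)) = Re (w * cnj (1 - w)) / (norm (1 - w))\<^sup>2"
          by (simp only: Re_divide_of_real)
        moreover have "2 * Re (w * cnj (1 - w)) + (norm (1 - w))\<^sup>2 = 1 - (norm w)\<^sup>2"
          unfolding cmod_power2 by (simp add: power2_eq_square algebra_simps)
        ultimately show ?thesis
          using n by (simp add: field_simps)
      qed
      moreover have "(1 - (norm w)\<^sup>2) / (2 * (norm (1 - w))\<^sup>2) > 0"
        using n w by (intro divide_pos_pos) (auto simp: abs_square_less_1)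
      ultimately show ?thesis
        by linarith
    qed
    from this[OF z3[OF z]] have "c * Re (z ^ 3 / (1 - z ^ 3)) > c * (- 1 / 2)"
      using c by (rule mult_strict_left_mono)
    moreover have "z * deriv (deriv f) z / deriv f z = of_real c * (z ^ 3 / (1 - z ^ 3))"
      using T[OF z] by (simp add: power2_eq_square power3_eq_cube flip: times_divide_eq_right)
    then have "Re (1 + z * deriv (deriv f) z / deriv f z) = 1 + c * Re (z ^ 3 / (1 - z ^ 3))"
      by (simp only: plus_complex.sel one_complex.sel Re_complex_of_real Im_complex_of_real
          times_complex.sel)
    ultimately show ?thesis
      by (simp add: c_def field_simps)
  qed
  moreover have "f holomorphic_on ball 0 1"
    using df unfolding holomorphic_on_open[OF open_ball] by (meson mem_ball_0)
  ultimately have "f \<in> convex_class \<alpha>"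
    using f1 g_nz by (auto simp: convex_class_def normalized_analytic_def f_def g_def)
  then show ?thesis
    using that T unfolding c_def by blast
qed

theorem theorem2:
  fixes \<alpha> :: real
  assumes "- 1 / 2 \<le> \<alpha>" and "\<alpha> < 1"
  shows "(\<forall>f\<in>convex_class \<alpha>. cmod (deriv (schwarzian f) 0) \<le> 4 * (1 - \<alpha>)) \<and>
         (\<exists>f\<in>convex_class \<alpha>. cmod (deriv (schwarzian f) 0) = 4 * (1 - \<alpha>))"
proof (intro conjI ballI)
  define c where "c = 2 * (1 - \<alpha>)"
  have c: "0 < c" "c \<le> 3"
    using assms by (auto simp: c_def)
  have hol: "(\<lambda>z. deriv (deriv f) z / deriv f z) holomorphic_on ball 0 1"
    if "f \<in> convex_class \<alpha>" for f
    using that by (auto simp: convex_class_def normalized_analytic_def intro!: holomorphic_intros)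
  show "cmod (deriv (schwarzian f) 0) \<le> 4 * (1 - \<alpha>)" if f: "f \<in> convex_class \<alpha>" for f
  proof -
    obtain \<phi> where \<phi>: "\<phi> holomorphic_on ball 0 1" "\<And>z. norm z < 1 \<Longrightarrow> norm (\<phi> z) \<le> 1"
      "\<And>z. norm z < 1 \<Longrightarrow>
        deriv (deriv f) z / deriv f z = \<phi> z * (of_real c + z * (deriv (deriv f) z / deriv f z))"
      using convex_class_Schwarz_function[OF f assms(2)] unfolding c_def by blast
    have "cmod (deriv (schwarzian f) 0)
        = c * cmod (deriv (deriv \<phi>) 0 + (4 - c) * \<phi> 0 * deriv \<phi> 0 + (2 - c) * \<phi> 0 ^ 3)"
      using deriv_schwarzian_0[OF hol[OF f] \<phi>(1,3)] c by (simp add: norm_mult)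
    also have "\<dots> \<le> c * 2"
      using Schwarzian_functional_bound[OF \<phi>(1,2), of c] c by (intro mult_left_mono) auto
    finally show ?thesis
      by (simp add: c_def)
  qed
  obtain f where f: "f \<in> convex_class \<alpha>"
    and T: "\<And>z. norm z < 1 \<Longrightarrow> deriv (deriv f) z / deriv f z = of_real c * z\<^sup>2 / (1 - z ^ 3)"
    using convex_class_extremal[OF assms(2)] unfolding c_def by blast
  have "deriv (deriv f) z / deriv f z = z\<^sup>2 * (of_real c + z * (deriv (deriv f) z / deriv f z))"
    if "norm z < 1" for z
  proof -
    have "norm (z ^ 3) < 1"
      using that by (simp add: norm_power power_less_one_iff)
    then have "1 - z ^ 3 \<noteq> 0"
      by auto
    then show ?thesis
      unfolding T[OF that] by (simp add: field_simps power2_eq_square power3_eq_cube)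
  qed
  \<comment> \<open>For \<open>\<phi> = z\<^sup>2\<close> both the value and the first derivative
    vanish at 0, so only the second derivative 2 survives and the result is
    \<open>2 * c\<close>.\<close>
  then have "deriv (schwarzian f) 0 = of_real c * (deriv (deriv (\<lambda>z. z\<^sup>2)) 0
      + (4 - of_real c) * 0\<^sup>2 * deriv (\<lambda>z. z\<^sup>2) 0 + (2 - of_real c) * 0\<^sup>2 ^ 3)"
    by (intro deriv_schwarzian_0 hol f holomorphic_intros)
  moreover have "deriv (\<lambda>z::complex. z\<^sup>2) = (\<lambda>z. 2 * z)"
    by (auto intro!: DERIV_imp_deriv derivative_eq_intros)
  moreover have "deriv (\<lambda>z::complex. 2 * z) 0 = 2"
    by (auto intro!: DERIV_imp_deriv derivative_eq_intros)
  ultimately have "deriv (schwarzian f) 0 = of_real c * 2"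
    by simp
  then have "cmod (deriv (schwarzian f) 0) = c * 2"
    using c by (simp add: norm_mult)
  then have "cmod (deriv (schwarzian f) 0) = 4 * (1 - \<alpha>)"
    by (simp add: c_def)
  then show "\<exists>f\<in>convex_class \<alpha>. cmod (deriv (schwarzian f) 0) = 4 * (1 - \<alpha>)"
    using f by blast
qed

end
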